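(* For every integer $n\ge 1$, the number of collapsed permutations in $S_{2n+1}$ equals the Genocchi number of the first kind $g_{2n+4}$.
   Context: A permutation $\pi\in S_N$ is collapsed if for every $k\in[N]$, $\pi^{-1}(k)\ge \lceil k/2\rceil$ when $N$ is odd (resp. $\pi^{-1}(k)\ge 1+\lfloor k/2\rfloor$ when $N$ is even), and $\pi^{-1}(k)\le \lceil N/2\rceil+\lfloor k/2\rfloor$. The (unsigned) Genocchi numbers of the first kind $g_{2n}$ are defined by $\sum_{n\ge 0} g_{2n}\,\frac{x^{2n}}{(2n)!}=x\tan(x/2)$; thus $g_2=1,g_4=1,g_6=3,g_8=17,g_{10}=155,\dots$. *)

theory Defs
  imports Complex_Main
    "HOL-Combinatorics.Permutations"
    "HOL-Computational_Algebra.Formal_Power_Series"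
begin

(* S_N is the set of maps p with "p permutes {1..N}", so that "inv p k" is the position of the
   value k in the one-line notation of p. *)
definition collapsed :: "nat \<Rightarrow> (nat \<Rightarrow> nat) \<Rightarrow> bool" where
  "collapsed N \<pi> \<longleftrightarrow> \<pi> permutes {1..N} \<and>
     (\<forall>k\<in>{1..N}.
        (if odd N then \<lceil>real k / 2\<rceil> \<le> int (inv \<pi> k) else 1 + \<lfloor>real k / 2\<rfloor> \<le> int (inv \<pi> k)) \<and>
        int (inv \<pi> k) \<le> \<lceil>real N / 2\<rceil> + \<lfloor>real k / 2\<rfloor>)"

(* The exponential generating function of the unsigned Genocchi numbers of the first kind is
   x tan (x / 2), as a formal power series; "fps_tan c" is the expansion of tan (c x).  The series
   is even, so the value at an odd index is 0. *)
definition genocchi :: "nat \<Rightarrow> rat" where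
  "genocchi m = fact m * fps_nth (fps_X * fps_tan (1 / 2)) m"

lemma genocchi_egf: "Abs_fps (\<lambda>m. genocchi m / fact m) = fps_X * fps_tan (1 / 2)"
  by (simp add: fps_eq_iff genocchi_def)

end

theory Submission
  imports Defs "HOL-Library.FuncSet"
begin

text \<open>
  Read by positions \<open>j\<close>, the condition on \<open>\<pi> \<in> S\<^bsub>2n+1\<^esub>\<close> is \<open>\<pi>(j) \<le> 2j\<close> for \<open>j \<le> n\<close>,
  nothing for \<open>j = n+1\<close>, and \<open>\<pi>(n+1+t) \<ge> 2t\<close> for \<open>1 \<le> t \<le> n\<close>.  Inclusion-exclusion over the
  set \<open>S\<close> of violated lower bounds \<open>\<pi>(n+1+t) \<le> 2t-1\<close> leaves only upper bounds, and
  such permutations are counted by a product, choosing values in order of increasing bound.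
  Adding the positions in the order \<open>1', 1, 2', 2, \<dots>\<close>, where \<open>t'\<close> stands for \<open>n+1+t\<close> and
  occurs only if \<open>t \<in> S\<close>, the new factors at index \<open>i\<close> depend on the earlier choices only
  through \<open>a = i - 1 - |S \<inter> {1..i-1}|\<close>, so that each index contributes one application of the
  operator \<open>(R \<phi>)(a) = (a+2) \<phi>(a+1) - (a+1)\<^sup>2 \<phi>(a)\<close>.  The count is thus \<open>(R\<^sup>n \<phi>)(0)\<close> for
  \<open>\<phi>(a) = (a+1)!\<close>, which is \<open>R\<close> applied to the factorial.

  On the other side let \<open>y = 2 sin (x/2)\<close> and
  \<open>Q\<^sub>\<phi> = \<Sum>\<^bsub>m\<ge>1\<^esub> \<phi>(m-1) m! y\<^bsup>2m\<^esup> / (2m)!\<close>.  The differential equation of \<open>y\<close> gives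
  \<open>Q\<^sub>\<phi>'' = \<phi>(0) + Q\<^bsub>R\<phi>\<^esub>\<close>, and the series of \<open>arcsin z / sqrt (1 - z\<^sup>2)\<close> gives
  \<open>Q\<^sub>\<phi> = x tan (x/2)\<close> when \<open>\<phi>\<close> is the factorial, so that \<open>g\<^bsub>2N+2\<^esub> = (R\<^sup>N fact)(0)\<close>.
\<close>

unbundle fps_syntax

subsection \<open>Generating function of the Genocchi numbers\<close>

definition genocchi_step :: "(nat \<Rightarrow> rat) \<Rightarrow> nat \<Rightarrow> rat" where
  "genocchi_step \<phi> a = of_nat (a + 2) * \<phi> (Suc a) - of_nat (Suc a) ^ 2 * \<phi> a"

lemma genocchi_step_fact: "genocchi_step fact = (\<lambda>a. fact (Suc a))"
  by (rule ext) (simp add: genocchi_step_def algebra_simps power2_eq_square)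

section \<open>Substitution of 2 sin (x/2) into a power series\<close>

definition two_sin_half :: "rat fps" where
  "two_sin_half = fps_const 2 * fps_sin (1 / 2)"

lemma two_sin_half_nth_0 [simp]: "two_sin_half $ 0 = 0"
  by (simp add: two_sin_half_def)

lemma fps_deriv_two_sin_half: "fps_deriv two_sin_half = fps_cos (1 / 2)"
proof -
  have "fps_deriv two_sin_half = (fps_const 2 * fps_const (1 / 2)) * fps_cos (1 / 2)"
    by (simp only: two_sin_half_def fps_sin_deriv fps_deriv_mult_const_left mult.assoc)
  then show ?thesis
    by simp
qed

lemma fps_deriv_cos_half: "fps_deriv (fps_cos (1 / 2)) = - (fps_const (1 / 4) * two_sin_half)"
proof -
  have "fps_const (- (1 / 2)) = - (fps_const (1 / 4) * fps_const (2 :: rat))"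
    by simp
  then show ?thesis
    unfolding fps_cos_deriv two_sin_half_def by (simp only: mult.assoc mult_minus_left)
qed

lemma cos_half_square: "fps_cos (1 / 2) ^ 2 = 1 - fps_const (1 / 4) * two_sin_half ^ 2"
proof -
  have "fps_const (1 / 4) * two_sin_half ^ 2
      = (fps_const (1 / 4) * fps_const 2 * fps_const 2) * fps_sin (1 / 2) ^ 2"
    by (simp only: two_sin_half_def power_mult_distrib power2_eq_square mult_ac)
  also have "\<dots> = fps_sin (1 / 2) ^ 2"
    by simp
  finally show ?thesis
    using fps_sin_cos_sum_of_squares[of "1 / 2 :: rat"] by (simp add: algebra_simps)
qed

lemmas compose_two_sin_half = fps_compose_mult_distrib[OF two_sin_half_nth_0]
  fps_compose_add_distrib fps_compose_sub_distrib
  fps_compose_power[OF two_sin_half_nth_0, symmetric] fps_X_fps_compose_startby0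

text \<open>By the chain rule the derivative is f'(y) cos^2 (x/2) - y f(y) / 4, and
  \<open>cos_half_square\<close> makes this a series in y alone. Taking f' for f yields second
  derivatives.\<close>

lemma fps_deriv_compose_times_cos:
  "fps_deriv ((f oo two_sin_half) * fps_cos (1 / 2)) =
    ((1 - fps_const (1 / 4) * fps_X ^ 2) * fps_deriv f - fps_const (1 / 4) * fps_X * f)
      oo two_sin_half"
  (is "_ = ?r")
proof -
  have "fps_deriv ((f oo two_sin_half) * fps_cos (1 / 2)) =
      (f oo two_sin_half) * (- (fps_const (1 / 4) * two_sin_half)) +
      (fps_deriv f oo two_sin_half) * fps_cos (1 / 2) ^ 2"
    by (simp add: fps_compose_deriv fps_deriv_cos_half fps_deriv_two_sin_half power2_eq_square
        mult_ac)
  also have "\<dots> = ?r"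
    unfolding cos_half_square by (simp add: compose_two_sin_half algebra_simps)
  finally show ?thesis .
qed

lemma fps_deriv2_compose:
  "fps_deriv (fps_deriv (f oo two_sin_half)) =
    ((1 - fps_const (1 / 4) * fps_X ^ 2) * fps_deriv (fps_deriv f)
      - fps_const (1 / 4) * fps_X * fps_deriv f) oo two_sin_half"
  unfolding fps_compose_deriv[OF two_sin_half_nth_0] fps_deriv_two_sin_half
    fps_deriv_compose_times_cos ..

section \<open>Weighted series and iteration of the step operator\<close>

text \<open>Composing with \<open>two_sin_half\<close> gives the series Q of the overview. The case
  k = 0 is separated because \<open>k div 2 - 1\<close> truncates to 0 there.\<close>

definition weighted_fps :: "(nat \<Rightarrow> rat) \<Rightarrow> rat fps" where
  "weighted_fps \<phi> =
    Abs_fps (\<lambda>k. if k = 0 \<or> odd k then 0 else \<phi> (k div 2 - 1) * fact (k div 2) / fact k)"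

lemma weighted_fps_nth:
  "weighted_fps \<phi> $ k =
    (if k = 0 \<or> odd k then 0 else \<phi> (k div 2 - 1) * fact (k div 2) / fact k)"
  by (simp add: weighted_fps_def)

text \<open>The contributions of z^2 f'' and z f' combine as k (k - 1) / 4 + k / 4 = k^2 /
  4.\<close>

lemma two_sin_half_operator_nth:
  "((1 - fps_const (1 / 4) * fps_X ^ 2) * fps_deriv (fps_deriv f)
      - fps_const (1 / 4) * fps_X * fps_deriv f) $ k =
    of_nat ((k + 1) * (k + 2)) * f $ (k + 2) - (of_nat k ^ 2 / 4) * (f $ k :: rat)"
proof (cases "k < 2")
  case True
  then have "k = 0 \<or> k = 1" by auto
  then show ?thesis
    by (auto simp: left_diff_distrib fps_mult_left_const_nth fps_X_power_mult_nth mult.assoc)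
next
  case False
  then obtain j where "k = j + 2"
    by (metis add.commute le_Suc_ex linorder_not_less)
  then show ?thesis
    by (simp add: left_diff_distrib fps_X_power_mult_nth mult.assoc)
      (simp add: field_simps power2_eq_square)
qed

text \<open>At k = 2 (a + 1) the factor (k + 1) (k + 2) cancels against (k + 2)!, and k^2 / 4 = (a +
  1)^2; with (a + 1)! / k! taken out, \<open>genocchi_step\<close> remains. The constant is the
  coefficient at k = 0.\<close>

lemma fps_deriv2_weighted:
  "fps_deriv (fps_deriv (weighted_fps \<phi> oo two_sin_half)) =
    fps_const (\<phi> 0) + (weighted_fps (genocchi_step \<phi>) oo two_sin_half)"
proof -
  have "((1 - fps_const (1 / 4) * fps_X ^ 2) * fps_deriv (fps_deriv (weighted_fps \<phi>))
      - fps_const (1 / 4) * fps_X * fps_deriv (weighted_fps \<phi>)) =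
      fps_const (\<phi> 0) + weighted_fps (genocchi_step \<phi>)"
  proof (rule fps_ext, unfold two_sin_half_operator_nth)
    fix k
    show "of_nat ((k + 1) * (k + 2)) * weighted_fps \<phi> $ (k + 2)
        - (of_nat k ^ 2 / 4) * weighted_fps \<phi> $ k
        = (fps_const (\<phi> 0) + weighted_fps (genocchi_step \<phi>)) $ k"
    proof (cases "k = 0 \<or> odd k")
      case True
      then show ?thesis by (auto simp: weighted_fps_nth)
    next
      case False
      then obtain a where k: "k = 2 * Suc a"
        by (metis evenE not0_implies_Suc mult_0_right)
      have f: "fact (k + 2) = of_nat ((k + 1) * (k + 2)) * (fact k :: rat)"
        by (simp add: algebra_simps)
      have "of_nat ((k + 1) * (k + 2)) * weighted_fps \<phi> $ (k + 2)
          = \<phi> (Suc a) * (of_nat (a + 2) * fact (Suc a)) / fact k"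
        unfolding weighted_fps_nth f using k by (simp del: of_nat_mult)
      moreover have "weighted_fps \<phi> $ k = \<phi> a * fact (Suc a) / fact k"
        using k by (simp add: weighted_fps_nth del: fact_Suc)
      moreover have "(fps_const (\<phi> 0) + weighted_fps (genocchi_step \<phi>)) $ k =
          genocchi_step \<phi> a * fact (Suc a) / fact k"
        using k by (simp add: weighted_fps_nth del: fact_Suc)
      moreover have "of_nat k ^ 2 / 4 = (of_nat (Suc a) ^ 2 :: rat)"
        unfolding k of_nat_mult power_mult_distrib by simp
      ultimately show ?thesis
        unfolding genocchi_step_def
        by (simp only: left_diff_distrib right_diff_distrib diff_divide_distrib times_divide_eq_right mult_ac)
    qed
  qed
  then show ?thesis
    unfolding fps_deriv2_compose by (simp add: fps_compose_add_distrib)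
qed

text \<open>Two derivatives lower the index by 2 and turn \<phi> into
  \<open>genocchi_step \<phi>\<close>, hence the induction over all \<phi>. The additive constant is
  seen only at index 0, in the base case.\<close>

lemma weighted_fps_compose_nth:
  "fact (2 * N + 2) * (weighted_fps \<phi> oo two_sin_half) $ (2 * N + 2) =
    (genocchi_step ^^ N) \<phi> 0"
proof (induction N arbitrary: \<phi>)
  case 0
  have "fps_deriv (fps_deriv (weighted_fps \<phi> oo two_sin_half)) $ 0 = \<phi> 0"
    unfolding fps_deriv2_weighted by (simp add: weighted_fps_nth)
  then show ?case
    by (simp add: numeral_2_eq_2)
next
  case (Suc N)
  let ?f = "weighted_fps \<phi> oo two_sin_half"
  have "fact (M + 2) = fact M * (of_nat ((M + 1) * (M + 2)) :: rat)" for M :: nat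
    by (simp add: algebra_simps)
  moreover have "2 * N + 2 + 1 = 2 * N + 3" "2 * N + 2 + 2 = 2 * N + 4" "2 * Suc N + 2 = 2 * N + 4"
    by simp_all
  ultimately
  have f: "fact (2 * Suc N + 2) = fact (2 * N + 2) * (of_nat ((2 * N + 3) * (2 * N + 4)) :: rat)"
    by metis
  have "fps_deriv (fps_deriv ?f) $ (2 * N + 2) =
      of_nat ((2 * N + 3) * (2 * N + 4)) * ?f $ (2 * Suc N + 2)"
    by (simp add: numeral_eq_Suc mult_ac) (simp add: algebra_simps)
  moreover have "fps_deriv (fps_deriv ?f) $ (2 * N + 2) =
      (weighted_fps (genocchi_step \<phi>) oo two_sin_half) $ (2 * N + 2)"
    unfolding fps_deriv2_weighted by simp
  ultimately have "fact (2 * Suc N + 2) * ?f $ (2 * Suc N + 2) =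
      fact (2 * N + 2) * (weighted_fps (genocchi_step \<phi>) oo two_sin_half) $ (2 * N + 2)"
    unfolding f by (simp only: mult.assoc)
  also have "\<dots> = (genocchi_step ^^ N) (genocchi_step \<phi>) 0"
    by (rule Suc.IH)
  finally show ?case
    by (simp add: funpow_swap1)
qed

text \<open>Here \<open>g\<close> is arcsin (z/2) / sqrt (1 - z^2/4), handled through its linear
  differential equation. That equation gives g(y) cos (x/2) the derivative 1/2, so this product is
  x/2; multiplying by y = 2 sin (x/2) gives x sin (x/2), and cos (x/2) can be cancelled.\<close>

lemma weighted_fps_fact:
  "weighted_fps fact oo two_sin_half = fps_X * fps_tan (1 / 2)"
proof -
  define g where "g = Abs_fps (\<lambda>k. weighted_fps fact $ Suc k)"
  let ?G = "(g oo two_sin_half) * fps_cos (1 / 2)"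
  have gX: "weighted_fps fact = fps_X * g"
    by (rule fps_ext) (auto simp: g_def weighted_fps_nth)
  have "(1 - fps_const (1 / 4) * fps_X ^ 2) * fps_deriv g - fps_const (1 / 4) * fps_X * g
      = fps_const (1 / 2)"
  proof (rule fps_ext)
    fix k
    have *: "((1 - fps_const (1 / 4) * fps_X ^ 2) * fps_deriv g
        - fps_const (1 / 4) * fps_X * g) $ k =
        of_nat (k + 1) * weighted_fps fact $ (k + 2) - of_nat k / 4 * weighted_fps fact $ k"
    proof (cases "k < 2")
      case True
      then have "k = 0 \<or> k = 1" by auto
      then show ?thesis
        by (auto simp: left_diff_distrib fps_X_power_mult_nth mult.assoc g_def numeral_2_eq_2)
    next
      case False
      then obtain j where "k = Suc (Suc j)"
        by (metis add_2_eq_Suc le_Suc_ex linorder_not_less)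
      then show ?thesis
        by (simp add: left_diff_distrib fps_X_power_mult_nth mult.assoc g_def)
          (simp add: field_simps)
    qed
    show "((1 - fps_const (1 / 4) * fps_X ^ 2) * fps_deriv g
        - fps_const (1 / 4) * fps_X * g) $ k = fps_const (1 / 2) $ k"
    proof (cases "k = 0 \<or> odd k")
      case True
      then show ?thesis unfolding * by (auto simp: weighted_fps_nth)
    next
      case False
      then obtain a where k: "k = 2 * Suc a"
        by (metis evenE not0_implies_Suc mult_0_right)
      have f: "fact (k + 2) = of_nat (k + 1) * of_nat (2 * (a + 2)) * (fact k :: rat)"
        unfolding k by (simp add: algebra_simps)
      \<comment> \<open>Both terms of the coefficient equal (a + 1)!^2 / (2 k!), so they
        cancel.\<close>
      have "of_nat (k + 1) * weighted_fps fact $ (k + 2)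
          = fact (Suc a) * fact (Suc (Suc a)) / (of_nat (2 * (a + 2)) * fact k :: rat)"
        unfolding weighted_fps_nth f using k by (simp del: fact_Suc of_nat_mult of_nat_add)
      also have "fact (Suc (Suc a)) = of_nat (a + 2) * (fact (Suc a) :: rat)"
        by simp
      also have "fact (Suc a) * (of_nat (a + 2) * fact (Suc a)) / (of_nat (2 * (a + 2)) * fact k) =
          fact (Suc a) * fact (Suc a) / (2 * fact k :: rat)"
        by (simp add: divide_simps del: fact_Suc of_nat_add)
      also have "\<dots> = of_nat k / 4 * (fact a * fact (Suc a) / fact k)"
      proof -
        have "of_nat k = 2 * (of_nat (Suc a) :: rat)"
          unfolding k by simp
        then show ?thesis
          by (simp add: fact_Suc[of a] field_simps del: of_nat_Suc)
      qed
      also have "\<dots> = of_nat k / 4 * weighted_fps fact $ k"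
        using k by (simp add: weighted_fps_nth del: fact_Suc)
      finally show ?thesis
        unfolding * using k by simp
    qed
  qed
  then have "fps_deriv ?G = fps_deriv (fps_const (1 / 2) * fps_X)"
    unfolding fps_deriv_compose_times_cos by simp
  moreover have "?G $ 0 = 0"
    by (simp add: g_def weighted_fps_nth)
  ultimately have G: "?G = fps_const (1 / 2) * fps_X"
    unfolding fps_deriv_eq_iff by simp
  have "(weighted_fps fact oo two_sin_half) * fps_cos (1 / 2) = two_sin_half * ?G"
    unfolding gX by (simp add: compose_two_sin_half mult.assoc)
  also have "\<dots> = (fps_const 2 * fps_const (1 / 2)) * (fps_X * fps_sin (1 / 2))"
    unfolding G unfolding two_sin_half_def by (simp only: mult_ac)
  also have "\<dots> = (fps_X * fps_tan (1 / 2)) * fps_cos (1 / 2)"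
    by (simp add: fps_tan_def mult.assoc fps_divide_times_eq)
  finally show ?thesis
    by (metis fps_cos_nth_0 fps_zero_nth mult_right_cancel zero_neq_one)
qed

lemma genocchi_eq_step_power: "genocchi (2 * N + 2) = (genocchi_step ^^ N) fact 0"
  unfolding genocchi_def weighted_fps_fact[symmetric] by (rule weighted_fps_compose_nth)

subsection \<open>Injections with upper bounds\<close>

text \<open>Extensionality fixes the values off \<open>I\<close>, so for finite \<open>I\<close> the
  set is finite and a new position means exactly one new value.\<close>

definition bounded_inj :: "'a set \<Rightarrow> ('a \<Rightarrow> nat) \<Rightarrow> ('a \<Rightarrow> nat) set" where
  "bounded_inj I b = {f \<in> (\<Pi>\<^sub>E j\<in>I. {1..b j}). inj_on f I}"

lemma finite_bounded_inj: "finite I \<Longrightarrow> finite (bounded_inj I b)"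
  unfolding bounded_inj_def by (rule finite_subset[OF _ finite_PiE[of I "\<lambda>j. {1..b j}"]]) auto

lemma bounded_inj_cong: "(\<And>j. j \<in> I \<Longrightarrow> b j = b' j) \<Longrightarrow> bounded_inj I b = bounded_inj I b'"
  unfolding bounded_inj_def by (simp cong: PiE_cong)

lemma card_bounded_inj_empty [simp]: "card (bounded_inj {} b) = 1"
  by (simp add: bounded_inj_def)

text \<open>As \<open>b x\<close> is the largest bound, all values used on \<open>I\<close> lie in
  \<open>{1..b x}\<close>, so the number of choices at \<open>x\<close> is the same for every
  injection being extended.\<close>

lemma card_bounded_inj_insert:
  assumes "finite I" "x \<notin> I" and mono: "\<And>j. j \<in> I \<Longrightarrow> b j \<le> b x"
  shows "card (bounded_inj (insert x I) b) = card (bounded_inj I b) * (b x - card I)"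
proof -
  let ?S = "SIGMA f:bounded_inj I b. {1..b x} - f ` I"
  \<comment> \<open>An injection splits into its part on \<open>I\<close>, made extensional again by
    resetting \<open>x\<close> to \<open>undefined\<close>, and a fresh value at
    \<open>x\<close>.\<close>
  have "bij_betw (\<lambda>(f, y). f(x := y)) ?S (bounded_inj (insert x I) b)"
  proof (rule bij_betwI[where g = "\<lambda>f. (f(x := undefined), f x)"])
    show "(\<lambda>(f, y). f(x := y)) \<in> ?S \<rightarrow> bounded_inj (insert x I) b"
    proof
      fix p assume "p \<in> ?S"
      then obtain f y where p: "p = (f, y)" and f: "f \<in> (\<Pi>\<^sub>E j\<in>I. {1..b j})" "inj_on f I"
        and y: "y \<in> {1..b x}" "y \<notin> f ` I"
        by (auto simp: bounded_inj_def)
      have "f(x := y) ` I = f ` I"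
        using \<open>x \<notin> I\<close> by auto
      moreover have "inj_on (f(x := y)) I"
        using f(2) \<open>x \<notin> I\<close> by (auto simp: inj_on_def)
      ultimately have "inj_on (f(x := y)) (insert x I)"
        using y(2) by (auto simp: inj_on_insert)
      then show "(\<lambda>(f, y). f(x := y)) p \<in> bounded_inj (insert x I) b"
        using p f(1) y(1) PiE_fun_upd[of y "\<lambda>j. {1..b j}" x f I] by (simp add: bounded_inj_def)
    qed
    show "(\<lambda>f. (f(x := undefined), f x)) \<in> bounded_inj (insert x I) b \<rightarrow> ?S"
    proof
      fix f assume f: "f \<in> bounded_inj (insert x I) b"
      have "f(x := undefined) \<in> (\<Pi>\<^sub>E j\<in>I. {1..b j})"
        by (rule fun_upd_in_PiE) (use f \<open>x \<notin> I\<close> in \<open>auto simp: bounded_inj_def\<close>)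
      moreover have "inj_on (f(x := undefined)) I" "f x \<notin> f ` I"
        using f \<open>x \<notin> I\<close> by (auto simp: bounded_inj_def inj_on_def)
      moreover have "f(x := undefined) ` I = f ` I"
        using \<open>x \<notin> I\<close> by auto
      moreover have "f x \<in> {1..b x}"
        using f by (auto simp: bounded_inj_def)
      ultimately show "(f(x := undefined), f x) \<in> ?S"
        by (simp add: bounded_inj_def)
    qed
    show "(\<lambda>f. (f(x := undefined), f x)) ((\<lambda>(f, y). f(x := y)) p) = p" if p: "p \<in> ?S" for p
    proof -
      obtain f y where eq: "p = (f, y)" and "f \<in> bounded_inj I b"
        using p by auto
      then have "f \<in> extensional I"
        by (simp add: bounded_inj_def PiE_iff)
      then have "f x = undefined"
        using \<open>x \<notin> I\<close> by (simp add: extensional_def)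
      then show ?thesis
        using eq by (auto simp: fun_eq_iff)
    qed
    show "(\<lambda>(f, y). f(x := y)) (f(x := undefined), f x) = f" for f :: "'a \<Rightarrow> nat"
      by simp
  qed
  then have "card (bounded_inj (insert x I) b) = card ?S"
    by (simp add: bij_betw_same_card)
  also have "\<dots> = (\<Sum>f\<in>bounded_inj I b. card ({1..b x} - f ` I))"
    using \<open>finite I\<close> by (subst card_SigmaI) (auto simp: finite_bounded_inj)
  also have "\<dots> = (\<Sum>f\<in>bounded_inj I b. b x - card I)"
  proof (rule sum.cong)
    fix f assume f: "f \<in> bounded_inj I b"
    have "f ` I \<subseteq> {1..b x}"
      using f mono by (fastforce simp: bounded_inj_def PiE_iff)
    then show "card ({1..b x} - f ` I) = b x - card I"
      using f \<open>finite I\<close> by (simp add: card_Diff_subset bounded_inj_def card_image)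
  qed simp
  finally show ?thesis by simp
qed

text \<open>Moving \<open>D\<close> into \<open>I\<close> one position at a time, each finds
  \<open>N - card I\<close> values left, a number running from \<open>card D\<close> down to
  1.\<close>

lemma card_bounded_inj_complete:
  assumes "finite D" "finite I" "I \<inter> D = {}" "card I + card D = N"
    and "\<And>j. j \<in> I \<Longrightarrow> b j \<le> N" "\<And>j. j \<in> D \<Longrightarrow> b j = N"
  shows "card (bounded_inj (I \<union> D) b) = card (bounded_inj I b) * fact (card D)"
  using assms
proof (induction D arbitrary: I rule: finite_induct)
  case (insert d D)
  have "card (bounded_inj (insert d I \<union> D) b) = card (bounded_inj (insert d I) b) * fact (card D)"
    using insert.prems insert.hyps by (intro insert.IH) auto
  also have "card (bounded_inj (insert d I) b) = card (bounded_inj I b) * (N - card I)"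
    using insert.prems by (subst card_bounded_inj_insert) auto
  finally show ?case
    using insert.prems insert.hyps
    by (metis (no_types, lifting) Un_insert_left Un_insert_right add_diff_cancel_left' card_insert_disjoint fact_Suc mult.assoc of_nat_id)
qed simp

text \<open>Since all bounds are at most \<open>N\<close>, an injection obeying them maps
  \<open>{1..N}\<close> into itself, so it is bijective and extends by the identity.\<close>

lemma card_permutes_bounded:
  fixes b :: "nat \<Rightarrow> nat"
  assumes "\<And>j. j \<in> {1..N} \<Longrightarrow> b j \<le> N"
  shows "card {p. p permutes {1..N} \<and> (\<forall>j\<in>{1..N}. p j \<le> b j)} = card (bounded_inj {1..N} b)"
    (is "card ?P = _")
proof -
  have "bij_betw (\<lambda>p. restrict p {1..N}) ?P (bounded_inj {1..N} b)"
  proof (rule bij_betwI[where g = "\<lambda>f j. if j \<in> {1..N} then f j else j"])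
    show "(\<lambda>p. restrict p {1..N}) \<in> ?P \<rightarrow> bounded_inj {1..N} b"
    proof
      fix p assume p: "p \<in> ?P"
      then have "p ` {1..N} = {1..N}" "inj_on p {1..N}"
        by (auto simp: permutes_image permutes_inj_on)
      moreover have "1 \<le> p j" if "j \<in> {1..N}" for j
        using \<open>p ` {1..N} = {1..N}\<close> that by fastforce
      ultimately show "restrict p {1..N} \<in> bounded_inj {1..N} b"
        using p by (auto simp: bounded_inj_def)
    qed
    show "(\<lambda>f j. if j \<in> {1..N} then f j else j) \<in> bounded_inj {1..N} b \<rightarrow> ?P"
    proof
      fix f assume f: "f \<in> bounded_inj {1..N} b"
      let ?g = "\<lambda>j. if j \<in> {1..N} then f j else j"
      have le: "1 \<le> f j \<and> f j \<le> b j" if "j \<in> {1..N}" for j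
        using f that by (auto simp: bounded_inj_def PiE_iff)
      have "f ` {1..N} \<subseteq> {1..N}"
      proof
        fix y assume "y \<in> f ` {1..N}"
        then obtain j where "j \<in> {1..N}" "y = f j" by auto
        then show "y \<in> {1..N}"
          using le[of j] assms[of j] by simp
      qed
      moreover have "inj_on f {1..N}"
        using f by (simp add: bounded_inj_def)
      ultimately have "bij_betw f {1..N} {1..N}"
        by (simp add: bij_betw_def endo_inj_surj)
      then have "bij_betw ?g {1..N} {1..N}"
        by (rule bij_betw_cong[THEN iffD1, rotated]) simp
      then have "?g permutes {1..N}"
        by (rule bij_imp_permutes) auto
      then show "?g \<in> ?P" using le by simp
    qed
    show "(\<lambda>j. if j \<in> {1..N} then restrict p {1..N} j else j) = p" if "p \<in> ?P" for p
      using that by (auto simp: permutes_def)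
    show "restrict (\<lambda>j. if j \<in> {1..N} then f j else j) {1..N} = f"
      if "f \<in> bounded_inj {1..N} b" for f
      by (rule extensionalityI[of _ "{1..N}"]) (use that in \<open>auto simp: bounded_inj_def PiE_def\<close>)
  qed
  then show ?thesis by (rule bij_betw_same_card)
qed

subsection \<open>Counting collapsed permutations\<close>

text \<open>For each x, the indicator that no \<open>Q t x\<close> holds is a product of factors 1 -
  [Q t x], which is expanded over the subsets of \<open>T\<close>.\<close>

lemma card_none_inclusion_exclusion:
  fixes Q :: "'b \<Rightarrow> 'c \<Rightarrow> bool"
  assumes "finite A" "finite T"
  shows "of_nat (card {x \<in> A. \<forall>t\<in>T. \<not> Q t x}) =
    (\<Sum>S\<in>Pow T. (-1) ^ card S * (of_nat (card {x \<in> A. \<forall>t\<in>S. Q t x}) :: 'a :: comm_ring_1))"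
proof -
  have all: "(\<Prod>t\<in>S. of_bool (R t)) = (of_bool (\<forall>t\<in>S. R t) :: 'a)" if "finite S"
    for S :: "'b set" and R
    using that by (induction S rule: finite_induct) auto
  have card: "of_nat (card {x \<in> A. R x}) = (\<Sum>x\<in>A. of_bool (R x) :: 'a)" for R
    using \<open>finite A\<close> by (simp add: of_bool_def sum.If_cases Int_def)
  have "of_nat (card {x \<in> A. \<forall>t\<in>T. \<not> Q t x}) = (\<Sum>x\<in>A. \<Prod>t\<in>T. 1 - of_bool (Q t x) :: 'a)"
    unfolding card using all[OF \<open>finite T\<close>] by (simp add: of_bool_not_iff[symmetric])
  also have "\<dots> = (\<Sum>x\<in>A. \<Sum>S\<in>Pow T. (-1) ^ card S * of_bool (\<forall>t\<in>S. Q t x))"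
    using \<open>finite T\<close>
    by (intro sum.cong refl) (auto simp: prod_diff_conv_sum all finite_subset intro!: sum.cong)
  also have "\<dots> = (\<Sum>S\<in>Pow T. (-1) ^ card S * of_nat (card {x \<in> A. \<forall>t\<in>S. Q t x}))"
    unfolding card by (subst sum.swap) (simp add: sum_distrib_left)
  finally show ?thesis .
qed

text \<open>Substituting k = p(j) removes the inverse. The upper bound 2j is vacuous for j > n, the
  lower bound for j \<le> n + 1. Lower bounds appear as negations, ready for
  inclusion-exclusion.\<close>

lemma collapsed_odd_iff:
  "collapsed (2 * n + 1) p \<longleftrightarrow> p permutes {1..2 * n + 1} \<and>
    (\<forall>j\<in>{1..n}. p j \<le> 2 * j) \<and> (\<forall>t\<in>{1..n}. \<not> p (n + 1 + t) \<le> 2 * t - 1)"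
proof (cases "p permutes {1..2 * n + 1}")
  case True
  let ?C = "\<lambda>k j. \<lceil>real k / 2\<rceil> \<le> int j \<and> int j \<le> \<lceil>real (2 * n + 1) / 2\<rceil> + \<lfloor>real k / 2\<rfloor>"
  have C: "?C k j \<longleftrightarrow> k \<le> 2 * j \<and> j \<le> n + 1 + k div 2" for k j
  proof -
    have "\<lceil>real k / 2\<rceil> \<le> int j \<longleftrightarrow> k \<le> 2 * j"
      by (simp add: ceiling_le_iff) linarith
    moreover have "\<lceil>real (2 * n + 1) / 2\<rceil> = int n + 1"
      by (rule ceiling_unique) auto
    moreover have "\<lfloor>real k / 2\<rfloor> = int (k div 2)"
      using floor_divide_of_nat_eq[of k 2] by simp
    ultimately show ?thesis by linarith
  qed
  have "collapsed (2 * n + 1) p \<longleftrightarrow> (\<forall>k\<in>{1..2 * n + 1}. ?C k (inv p k))"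
    using True by (simp add: collapsed_def)
  also have "\<dots> \<longleftrightarrow> (\<forall>k\<in>p ` {1..2 * n + 1}. ?C k (inv p k))"
    using permutes_image[OF True] by simp
  also have "\<dots> \<longleftrightarrow> (\<forall>j\<in>{1..2 * n + 1}. p j \<le> 2 * j \<and> j \<le> n + 1 + p j div 2)"
    unfolding C using permutes_inverses(2)[OF True] by simp
  also have "\<dots> \<longleftrightarrow> (\<forall>j\<in>{1..n}. p j \<le> 2 * j) \<and> (\<forall>t\<in>{1..n}. \<not> p (n + 1 + t) \<le> 2 * t - 1)"
    (is "?L \<longleftrightarrow> ?R")
  proof
    assume ?L
    show ?R
    proof (intro conjI ballI)
      fix t assume "t \<in> {1..n}"
      then have "n + 1 + t \<in> {1..2 * n + 1}"
        by simp
      with \<open>?L\<close> have "n + 1 + t \<le> n + 1 + p (n + 1 + t) div 2"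
        by blast
      then show "\<not> p (n + 1 + t) \<le> 2 * t - 1"
        using \<open>t \<in> {1..n}\<close> by simp linarith
    qed (use \<open>?L\<close> in simp)
  next
    assume R: ?R
    show ?L
    proof
      fix j assume j: "j \<in> {1..2 * n + 1}"
      have "p j \<le> 2 * n + 1"
        using permutes_in_image[OF True, of j] j by simp
      consider "j \<in> {1..n}" | "j = n + 1" | t where "t \<in> {1..n}" "j = n + 1 + t"
      proof -
        have "j \<in> {1..n} \<or> j = n + 1 \<or> j - (n + 1) \<in> {1..n} \<and> j = n + 1 + (j - (n + 1))"
          using j by auto
        then show ?thesis using that by blast
      qed
      then show "p j \<le> 2 * j \<and> j \<le> n + 1 + p j div 2"
      proof cases
        case 3
        then have "\<not> p j \<le> 2 * t - 1" using R by blast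
        with 3 \<open>p j \<le> 2 * n + 1\<close> show ?thesis by auto
      qed (use R \<open>p j \<le> 2 * n + 1\<close> in auto)
    qed
  qed
  finally show ?thesis using True by simp
qed (simp add: collapsed_def)

section \<open>Boards of upper bounds and their signed sum\<close>

text \<open>These are the bounded positions after index i: the first i ones, and those whose lower
  bound is taken to be violated.\<close>

definition board_index :: "nat \<Rightarrow> nat \<Rightarrow> nat set \<Rightarrow> nat set" where
  "board_index n i S = {1..i} \<union> (+) (n + 1) ` S"

definition board_bound :: "nat \<Rightarrow> nat \<Rightarrow> nat" where
  "board_bound n j = (if j \<le> n then 2 * j else 2 * (j - (n + 1)) - 1)"

definition board_count :: "nat \<Rightarrow> nat \<Rightarrow> nat set \<Rightarrow> nat" where
  "board_count n i S = card (bounded_inj (board_index n i S) (board_bound n))"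

lemma finite_board_index: "finite S \<Longrightarrow> finite (board_index n i S)"
  by (simp add: board_index_def)

lemma card_board_index:
  assumes "i \<le> n" "finite S"
  shows "card (board_index n i S) = i + card S"
  using assms unfolding board_index_def
  by (subst card_Un_disjoint) (auto simp: card_image inj_on_def)

lemma board_bound_le:
  assumes "S \<subseteq> {1..i}" "i \<le> n" "j \<in> board_index n i S"
  shows "board_bound n j \<le> 2 * i"
  using assms by (fastforce simp: board_index_def board_bound_def)

text \<open>All earlier bounds are at most 2i, and i + |S| of the 2i + 2 values allowed at the new
  position are taken.\<close>

lemma board_count_Suc:
  assumes S: "S \<subseteq> {1..i}" and i: "Suc i \<le> n"
  shows "board_count n (Suc i) S = board_count n i S * (i + 2 - card S)"
proof -
  have fin: "finite S" using S finite_subset by blast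
  have eq: "board_index n (Suc i) S = insert (Suc i) (board_index n i S)"
    by (auto simp: board_index_def)
  have "board_bound n j \<le> board_bound n (Suc i)" if "j \<in> board_index n i S" for j
    using board_bound_le[OF S _ that] i by (simp add: board_bound_def)
  moreover have "Suc i \<notin> board_index n i S"
    using i by (auto simp: board_index_def)
  ultimately show ?thesis
    unfolding board_count_def eq using i fin
    by (subst card_bounded_inj_insert)
      (simp_all add: finite_board_index card_board_index board_bound_def)
qed

text \<open>The new bounds are 2i + 1 and 2i + 2. With the smaller one first, i + |S| and then i +
  |S| + 1 values are taken, so both positions have i + 1 - |S| choices.\<close>

lemma board_count_insert:
  assumes S: "S \<subseteq> {1..i}" and i: "Suc i \<le> n"
  shows "board_count n (Suc i) (insert (Suc i) S) = board_count n i S * (Suc i - card S) ^ 2"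
proof -
  define x where "x = n + 1 + Suc i"
  let ?J = "insert x (board_index n i S)"
  have fin: "finite S" using S finite_subset by blast
  have eq: "board_index n (Suc i) (insert (Suc i) S) = insert (Suc i) ?J"
    by (auto simp: board_index_def x_def)
  have le: "board_bound n j \<le> 2 * i" if "j \<in> board_index n i S" for j
    using board_bound_le[OF S _ that] i by simp
  have b: "board_bound n x = 2 * i + 1" "board_bound n (Suc i) = 2 * i + 2"
    using i by (simp_all add: board_bound_def x_def)
  have new: "x \<notin> board_index n i S" "Suc i \<notin> ?J"
    using S i by (auto simp: board_index_def x_def)
  have "card (bounded_inj ?J (board_bound n)) = board_count n i S * (Suc i - card S)"
    unfolding board_count_def using new(1) fin le i
    by (subst card_bounded_inj_insert)
      (auto simp: finite_board_index card_board_index b le_SucI)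
  moreover have "card (bounded_inj (insert (Suc i) ?J) (board_bound n)) =
      card (bounded_inj ?J (board_bound n)) * (2 * i + 2 - card ?J)"
    unfolding b(2)[symmetric]
    by (rule card_bounded_inj_insert)
      (use new(2) fin le b in \<open>auto simp: finite_board_index le_SucI\<close>)
  moreover have "card ?J = Suc (i + card S)"
    using new(1) fin i by (subst card_insert_disjoint) (simp_all add: finite_board_index card_board_index)
  ultimately show ?thesis
    unfolding board_count_def[of n "Suc i"] eq by (simp add: power2_eq_square)
qed

text \<open>Subsets of {1..i+1} are split by whether they contain i + 1. With a = i - |S| the halves
  contribute (a + 2) \<phi>(a + 1) and, with the sign of the extra element, -(a + 1)^2 \<phi>(a).
  Removing the last index changes \<phi>, so \<phi> is kept arbitrary.\<close>

lemma sum_board_count: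
  assumes "i \<le> n"
  shows "(\<Sum>S\<in>Pow {1..i}. (-1) ^ card S * of_nat (board_count n i S) * \<phi> (i - card S)) =
    (genocchi_step ^^ i) \<phi> 0"
  using assms
proof (induction i arbitrary: \<phi>)
  case 0
  then show ?case by (simp add: board_count_def board_index_def)
next
  case (Suc i)
  let ?t = "\<lambda>i S. (-1) ^ card S * of_nat (board_count n i S) :: rat"
  have "(\<Sum>S\<in>Pow {1..Suc i}. ?t (Suc i) S * \<phi> (Suc i - card S)) =
      (\<Sum>S\<in>Pow {1..i}. ?t (Suc i) S * \<phi> (Suc i - card S)) +
      (\<Sum>S\<in>insert (Suc i) ` Pow {1..i}. ?t (Suc i) S * \<phi> (Suc i - card S))"
  proof -
    have "{1..Suc i} = insert (Suc i) {1..i}" by auto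
    then show ?thesis
      by (simp only: Pow_insert) (rule sum.union_disjoint; auto)
  qed
  also have "(\<Sum>S\<in>insert (Suc i) ` Pow {1..i}. ?t (Suc i) S * \<phi> (Suc i - card S)) =
      (\<Sum>S\<in>Pow {1..i}. ?t (Suc i) (insert (Suc i) S) * \<phi> (Suc i - card (insert (Suc i) S)))"
  proof (rule sum.reindex_cong[of "insert (Suc i)"])
    show "inj_on (insert (Suc i)) (Pow {1..i})"
      by (rule inj_on_inverseI[where g = "\<lambda>S. S - {Suc i}"]) auto
  qed simp_all
  also have "(\<Sum>S\<in>Pow {1..i}. ?t (Suc i) S * \<phi> (Suc i - card S)) + \<dots> =
      (\<Sum>S\<in>Pow {1..i}. ?t i S * genocchi_step \<phi> (i - card S))"
    unfolding sum.distrib[symmetric]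
  proof (rule sum.cong[OF refl])
    fix S assume "S \<in> Pow {1..i}"
    then have S: "S \<subseteq> {1..i}" by simp
    then have fin: "finite S" and le: "card S \<le> i"
      using finite_subset card_mono[OF _ S] by auto
    have "Suc i \<notin> S" using S by auto
    then have c: "card (insert (Suc i) S) = Suc (card S)" using fin by simp
    \<comment> \<open>Writing i as a sum disposes of the truncated subtractions.\<close>
    obtain a where "i = a + card S" using le by (metis le_add_diff_inverse2)
    then have a: "i - card S = a" "Suc i - card S = Suc a" "Suc i - Suc (card S) = a"
        "i + 2 - card S = a + 2"
      by simp_all
    show "?t (Suc i) S * \<phi> (Suc i - card S) +
        ?t (Suc i) (insert (Suc i) S) * \<phi> (Suc i - card (insert (Suc i) S)) =
        ?t i S * genocchi_step \<phi> (i - card S)"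
      unfolding board_count_Suc[OF S Suc.prems] board_count_insert[OF S Suc.prems] c genocchi_step_def a
        of_nat_mult of_nat_power power_Suc
      by (simp only: mult_minus_left mult_1_left right_diff_distrib mult_ac add_uminus_conv_diff)
  qed
  also have "\<dots> = (genocchi_step ^^ i) (genocchi_step \<phi>) 0"
    using Suc.prems by (intro Suc.IH) simp
  finally show ?case by (simp add: funpow_swap1)
qed

text \<open>The board covers n + |S| of the 2n + 1 positions; the other n + 1 - |S| are free and
  give the factorial.\<close>

lemma card_bounded_permutations:
  assumes S: "S \<subseteq> {1..n}"
  shows "card {p. p permutes {1..2 * n + 1} \<and> (\<forall>j\<in>{1..n}. p j \<le> 2 * j) \<and>
      (\<forall>t\<in>S. p (n + 1 + t) \<le> 2 * t - 1)} = board_count n n S * fact (Suc (n - card S))"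
    (is "card ?P = _")
proof -
  let ?N = "2 * n + 1" and ?I = "board_index n n S"
  \<comment> \<open>The default 2n + 1 does not restrict a permutation, and it is the top bound that
    \<open>card_bounded_inj_complete\<close> expects at free positions.\<close>
  define b where "b j = (if j \<in> ?I then board_bound n j else ?N)" for j
  have fin: "finite S" and le: "card S \<le> n"
    using S finite_subset card_mono[OF _ S] by auto
  have sub: "?I \<subseteq> {1..?N}"
    using S by (auto simp: board_index_def)
  have b_le: "b j \<le> ?N" for j
    using board_bound_le[OF S, of n j] by (auto simp: b_def)
  have "(\<forall>j\<in>{1..?N}. p j \<le> b j) \<longleftrightarrow>
      (\<forall>j\<in>{1..n}. p j \<le> 2 * j) \<and> (\<forall>t\<in>S. p (n + 1 + t) \<le> 2 * t - 1)"
    if p: "p permutes {1..?N}" for p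
  proof -
    have "p j \<le> ?N" if "j \<in> {1..?N}" for j
      using permutes_in_image[OF p, of j] that by simp
    then have "p j \<le> b j \<longleftrightarrow> (j \<in> ?I \<longrightarrow> p j \<le> board_bound n j)" if "j \<in> {1..?N}" for j
      using that by (simp add: b_def)
    then have "(\<forall>j\<in>{1..?N}. p j \<le> b j) \<longleftrightarrow> (\<forall>j\<in>?I. p j \<le> board_bound n j)"
      using sub by blast
    moreover have "board_bound n (n + 1 + t) = 2 * t - 1" if "t \<in> S" for t
      using that S by (auto simp: board_bound_def)
    moreover have "board_bound n j = 2 * j" if "j \<in> {1..n}" for j
      using that by (simp add: board_bound_def)
    ultimately show ?thesis
      by (simp only: board_index_def ball_Un ball_simps cong: ball_cong)
  qed
  then have "?P = {p. p permutes {1..?N} \<and> (\<forall>j\<in>{1..?N}. p j \<le> b j)}"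
    by blast
  also have "card \<dots> = card (bounded_inj {1..?N} b)"
    by (rule card_permutes_bounded) (rule b_le)
  also have "\<dots> = card (bounded_inj (?I \<union> ({1..?N} - ?I)) b)"
    using sub by (simp only: Un_Diff_cancel Un_absorb1)
  also have "\<dots> = card (bounded_inj ?I b) * fact (card ({1..?N} - ?I))"
  proof (rule card_bounded_inj_complete[where N = ?N])
    show "finite ?I"
      using fin by (rule finite_board_index)
    show "card ?I + card ({1..?N} - ?I) = ?N"
      using \<open>finite ?I\<close> card_mono[OF _ sub] sub by (simp add: card_Diff_subset)
    show "b j \<le> ?N" if "j \<in> ?I" for j
      by (rule b_le)
    show "b j = ?N" if "j \<in> {1..?N} - ?I" for j
      using that by (simp add: b_def)
  qed (use fin in auto)
  also have "card ({1..?N} - ?I) = Suc (n - card S)"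
    using sub fin le by (simp add: card_Diff_subset finite_board_index card_board_index Suc_diff_le)
  also have "bounded_inj ?I b = bounded_inj ?I (board_bound n)"
    by (rule bounded_inj_cong) (simp add: b_def)
  finally show ?thesis
    by (simp only: board_count_def)
qed

theorem theorem4p2:
  fixes n :: nat
  assumes "n \<ge> 1"
  shows "of_nat (card {\<pi>. collapsed (2 * n + 1) \<pi>}) = genocchi (2 * n + 4)"
proof -
  let ?A = "{p. p permutes {1..2 * n + 1} \<and> (\<forall>j\<in>{1..n}. p j \<le> 2 * j)}"
  have "finite ?A"
    by (rule finite_subset[OF _ finite_permutations[of "{1..2 * n + 1}"]]) auto
  have "{\<pi>. collapsed (2 * n + 1) \<pi>} =
      {p \<in> ?A. \<forall>t\<in>{1..n}. \<not> p (n + 1 + t) \<le> 2 * t - 1}"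
    unfolding collapsed_odd_iff by blast
  then have "of_nat (card {\<pi>. collapsed (2 * n + 1) \<pi>}) =
      (\<Sum>S\<in>Pow {1..n}. (-1) ^ card S *
        (of_nat (card {p \<in> ?A. \<forall>t\<in>S. p (n + 1 + t) \<le> 2 * t - 1}) :: rat))"
    by (simp only: card_none_inclusion_exclusion[OF \<open>finite ?A\<close> finite_atLeastAtMost])
  also have "\<dots> = (\<Sum>S\<in>Pow {1..n}.
      (-1) ^ card S * of_nat (board_count n n S) * fact (Suc (n - card S)))"
  proof (rule sum.cong[OF refl])
    fix S assume "S \<in> Pow {1..n}"
    then show "(-1) ^ card S *
        (of_nat (card {p \<in> ?A. \<forall>t\<in>S. p (n + 1 + t) \<le> 2 * t - 1}) :: rat) =
        (-1) ^ card S * of_nat (board_count n n S) * fact (Suc (n - card S))"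
      using card_bounded_permutations[of S n] by (simp add: conj_assoc del: fact_Suc)
  qed
  \<comment> \<open>The weight (a + 1)! from the free positions is itself
    \<open>genocchi_step fact\<close>, so n + 1 applications result.\<close>
  also have "\<dots> = (genocchi_step ^^ n) (genocchi_step fact) 0"
    unfolding genocchi_step_fact by (rule sum_board_count) simp
  also have "\<dots> = genocchi (2 * Suc n + 2)"
    unfolding genocchi_eq_step_power by (simp add: funpow_swap1)
  also have "2 * Suc n + 2 = 2 * n + 4"
    by simp
  finally show ?thesis .
qed

end
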